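(* Let $n\ge 1$, $M\ge 1$, $A,N\in\mathbb{R}^{n\times n}$, $b\in\mathbb{R}^{n\times 1}$, $c\in\mathbb{R}^{1\times n}$, and let $F\in\mathbb{R}^{n\times n}$ be a perturbation of $A$. Put $$H_M(s_1,\ldots,s_M)=c\,(s_MI_n-A)^{-1}N(s_{M-1}I_n-A)^{-1}\cdots N(s_1I_n-A)^{-1}b,$$ $$\widetilde H_M(s_1,\ldots,s_M)=c\,(s_MI_n-(A+F))^{-1}N(s_{M-1}I_n-(A+F))^{-1}\cdots N(s_1I_n-(A+F))^{-1}b.$$ Assume that $\|F\|_2<1$ and $\|\mathcal{K}^{-1}(s)\|_{H_\infty}<1$, where $\mathcal{K}(s)=sI_n-A$. Assume also that all inverses occurring exist for $s_j\in i\mathbb{R}$ and all $H_2$-norms occurring are finite. Then $$\big\|H_M(s_1,\ldots,s_M)-\widetilde H_M(s_1,\ldots,s_M)\big\|_{H_2}^2=\mathcal{O}\big(\|F\|_2^2\big).$$ That is, TBIRKA satisfies the second condition of backward stability with respect to inexact linear solves.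
   Context: For a (matrix-valued) function $H_k$ of $k$ complex variables, $$\|H_k\|_{H_2}^2=\Big(\frac1{2\pi}\Big)^k\int_{-\infty}^{\infty}\cdots\int_{-\infty}^{\infty}\|H_k(i\omega_1,\ldots,i\omega_k)\|_F^2\,d\omega_1\cdots d\omega_k ,$$ $$\|H_k\|_{H_\infty}=\max_{\omega_1,\ldots,\omega_k\in\mathbb{R}}\|H_k(i\omega_1,\ldots,i\omega_k)\|_2 ,$$ where $i=\sqrt{-1}$, $\|\cdot\|_F$ is the Frobenius norm and $\|\cdot\|_2$ the spectral norm (the max is understood as a supremum). $I_n$ is the $n\times n$ identity, and $\mathcal{K}^{-1}(s)=(sI_n-A)^{-1}$. The $\mathcal{O}$-statement means: with $A,N,b,c,M$ fixed, there is a constant $C$ independent of $F$ such that the left side is at most $C\|F\|_2^2$ for all admissible $F$ (those satisfying the hypotheses, in particular $\|F\|_2<1$). TBIRKA (Truncated Bilinear Iterative Rational Krylov Algorithm) is a model order reduction algorithm for the bilinear system $\dot x=Ax+Nxu+bu$, $y=cx$. It works with the truncated representation $\zeta^M=\{H_1,\ldots,H_M\}$, where $H_k$ is the $k$-th order transfer function given by the formula for $H_M$ with $M$ replaced by $k$. The perturbed system is $\widetilde\zeta^M=\{\widetilde H_1,\ldots,\widetilde H_M\}$, obtained by replacing $A$ with $A+F$. The second condition of backward stability requires that the difference between the original and the perturbed system be of the order of the perturbation. In the form used here, it means $\|H_k-\widetilde H_k\|_{H_2}=\mathcal{O}(\|F\|_2)$ for every $k=1,\ldots,M$. *)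

theory Defs
  imports "HOL-Analysis.Analysis"
begin

text \<open>
  A \<open>p\<times>q\<close> matrix has type \<open>_ ^ 'q ^ 'p\<close>. A matrix-valued function of \<open>k\<close> complex variables has type
  \<open>(nat \<Rightarrow> complex) \<Rightarrow> complex ^ 'q ^ 'p\<close> and reads only the entries \<open>s 1, \<dots>, s k\<close> of its argument.
\<close>

definition frobenius_norm :: "complex ^ 'q ^ 'p \<Rightarrow> real" where
  "frobenius_norm X = sqrt (\<Sum>i\<in>UNIV. \<Sum>j\<in>UNIV. (cmod (X $ i $ j))\<^sup>2)"

text \<open>\<^term>\<open>norm\<close> on \<open>_ ^ 'q\<close> is the Euclidean norm, so this is the induced 2-norm.\<close>

definition spectral_norm :: "'a::real_normed_field ^ 'q ^ 'p \<Rightarrow> real" where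
  "spectral_norm X = onorm (\<lambda>v. X *v v)"

definition complex_matrix :: "real ^ 'q ^ 'p \<Rightarrow> complex ^ 'q ^ 'p" where
  "complex_matrix = map_matrix complex_of_real"

definition imaginary_axis :: "(nat \<Rightarrow> real) \<Rightarrow> nat \<Rightarrow> complex" where
  "imaginary_axis \<omega> = (\<lambda>j. \<i> * complex_of_real (\<omega> j))"

text \<open>
  The norms take values in \<^typ>\<open>ennreal\<close>, so that an infinite norm is \<open>\<infinity>\<close> rather than a junk
  real number. The domain \<open>{1..k} \<rightarrow>\<^sub>E UNIV\<close> is \<open>\<real>\<^sup>k\<close>, with coordinates indexed by \<open>1, \<dots>, k\<close>.
\<close>

definition hinf_norm :: "nat \<Rightarrow> ((nat \<Rightarrow> complex) \<Rightarrow> complex ^ 'q ^ 'p) \<Rightarrow> ennreal" where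
  "hinf_norm k H =
     (SUP \<omega> \<in> {1..k} \<rightarrow>\<^sub>E (UNIV :: real set). ennreal (spectral_norm (H (imaginary_axis \<omega>))))"

definition h2_norm_squared :: "nat \<Rightarrow> ((nat \<Rightarrow> complex) \<Rightarrow> complex ^ 'q ^ 'p) \<Rightarrow> ennreal" where
  "h2_norm_squared k H =
     ennreal ((1 / (2 * pi)) ^ k) *
     (\<integral>\<^sup>+ \<omega>. ennreal ((frobenius_norm (H (imaginary_axis \<omega>)))\<^sup>2)
        \<partial>(\<Pi>\<^sub>M j\<in>{1..k}. (lborel :: real measure)))"

definition h2_norm :: "nat \<Rightarrow> ((nat \<Rightarrow> complex) \<Rightarrow> complex ^ 'q ^ 'p) \<Rightarrow> ennreal" where
  "h2_norm k H =
     (if h2_norm_squared k H = \<infinity> then \<infinity> else ennreal (sqrt (enn2real (h2_norm_squared k H))))"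

lemma h2_norm_power2: "(h2_norm k H)\<^sup>2 = h2_norm_squared k H"
proof (cases "h2_norm_squared k H = \<infinity>")
  case True
  then show ?thesis by (simp add: h2_norm_def)
next
  case False
  then show ?thesis
    by (simp add: h2_norm_def ennreal_power ennreal_enn2real_if)
qed

text \<open>\<open>\<K>(s) = s I - A\<close>; its inverse is taken with \<^const>\<open>matrix_inv\<close>, which is
  meaningful only where \<open>\<K>(s)\<close> is invertible.\<close>

definition pencil :: "real ^ 'n ^ 'n \<Rightarrow> complex \<Rightarrow> complex ^ 'n ^ 'n" where
  "pencil A s = mat s - complex_matrix A"

definition invertible_on_imaginary_axis :: "real ^ 'n ^ 'n \<Rightarrow> bool" where
  "invertible_on_imaginary_axis A \<longleftrightarrow> (\<forall>\<omega>::real. invertible (pencil A (\<i> * complex_of_real \<omega>)))"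

definition resolvent :: "real ^ 'n ^ 'n \<Rightarrow> complex \<Rightarrow> complex ^ 'n ^ 'n" where
  "resolvent A s = matrix_inv (pencil A s)"

text \<open>\<open>K(s\<^sub>k) N K(s\<^sub>k\<^sub>-\<^sub>1) \<cdots> N K(s\<^sub>1) b\<close> where \<open>K\<close> is the resolvent, for \<open>k \<ge> 1\<close>;
  the value at \<open>k = 0\<close> is a dummy.\<close>

fun resolvent_chain ::
  "real ^ 'n ^ 'n \<Rightarrow> real ^ 'n ^ 'n \<Rightarrow> real ^ 1 ^ 'n \<Rightarrow> nat \<Rightarrow> (nat \<Rightarrow> complex) \<Rightarrow> complex ^ 1 ^ 'n"
where
  "resolvent_chain A N b 0 s = 0"
| "resolvent_chain A N b (Suc 0) s = resolvent A (s 1) ** complex_matrix b"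
| "resolvent_chain A N b (Suc (Suc k)) s =
     resolvent A (s (Suc (Suc k))) ** complex_matrix N ** resolvent_chain A N b (Suc k) s"

definition transfer_function ::
  "real ^ 'n ^ 'n \<Rightarrow> real ^ 'n ^ 'n \<Rightarrow> real ^ 1 ^ 'n \<Rightarrow> real ^ 'n ^ 1 \<Rightarrow> nat \<Rightarrow>
   (nat \<Rightarrow> complex) \<Rightarrow> complex ^ 1 ^ 1"
where
  "transfer_function A N b c k s = complex_matrix c ** resolvent_chain A N b k s"

definition transfer_error ::
  "real ^ 'n ^ 'n \<Rightarrow> real ^ 'n ^ 'n \<Rightarrow> real ^ 1 ^ 'n \<Rightarrow> real ^ 'n ^ 1 \<Rightarrow> nat \<Rightarrow> real ^ 'n ^ 'n \<Rightarrow>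
   (nat \<Rightarrow> complex) \<Rightarrow> complex ^ 1 ^ 1"
where
  "transfer_error A N b c k F s =
     transfer_function A N b c k s - transfer_function (A + F) N b c k s"

definition admissible_perturbation ::
  "real ^ 'n ^ 'n \<Rightarrow> real ^ 'n ^ 'n \<Rightarrow> real ^ 1 ^ 'n \<Rightarrow> real ^ 'n ^ 1 \<Rightarrow> nat \<Rightarrow> real ^ 'n ^ 'n \<Rightarrow> bool"
where
  "admissible_perturbation A N b c k F \<longleftrightarrow>
     spectral_norm F < 1 \<and>
     invertible_on_imaginary_axis (A + F) \<and>
     h2_norm k (transfer_error A N b c k F) < \<infinity>"

text \<open>The difference between the original and the perturbed truncated system
  \<open>{H\<^sub>1, \<dots>, H\<^sub>M}\<close> is of the order of the perturbation.\<close>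

definition second_backward_stability_condition ::
  "real ^ 'n ^ 'n \<Rightarrow> real ^ 'n ^ 'n \<Rightarrow> real ^ 1 ^ 'n \<Rightarrow> real ^ 'n ^ 1 \<Rightarrow> nat \<Rightarrow> bool"
where
  "second_backward_stability_condition A N b c M \<longleftrightarrow>
     (\<forall>k\<in>{1..M}. \<exists>C\<ge>0. \<forall>F. admissible_perturbation A N b c k F \<longrightarrow>
        h2_norm k (transfer_error A N b c k F) \<le> ennreal (C * spectral_norm F))"

end

theory Submission
  imports Defs "HOL-Probability.Sinc_Integral"
begin

text \<open>
  Uniformly in the admissible \<open>F\<close>, the resolvents of \<open>A\<close> and \<open>A + F\<close> at \<open>i\<omega>\<close> are bounded by
  \<open>D / (1 + \<bar>\<omega>\<bar>)\<close>. As their difference is \<open>- R F R'\<close>, replacing the \<open>M\<close> resolvents in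
  \<open>H\<^sub>M\<close> one at a time bounds the error pointwise by a multiple of
  \<open>\<parallel>F\<parallel> \<Prod>\<^sub>j 1 / (1 + \<bar>\<omega>\<^sub>j\<bar>)\<close>, which is square integrable over \<open>\<real>\<^sup>M\<close>.
\<close>

section \<open>Frobenius and spectral norm estimates for matrix products\<close>

lemma frobenius_norm_eq_norm: "frobenius_norm X = norm X"
  by (simp add: frobenius_norm_def norm_vec_def L2_set_def sum_nonneg)

lemma norm_matrix_vector_mult_le:
  fixes A :: "complex ^ 'n ^ 'm"
  shows "norm (A *v x) \<le> spectral_norm A * norm x"
  unfolding spectral_norm_def by (rule onorm) simp

lemma spectral_norm_nonneg:
  fixes A :: "'a::{euclidean_space,real_normed_field} ^ 'n ^ 'm"
  shows "0 \<le> spectral_norm A"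
  unfolding spectral_norm_def by (rule onorm_pos_le) simp

lemma norm_squared_sum_columns:
  fixes X :: "complex ^ 'q ^ 'n"
  shows "(norm X)\<^sup>2 = (\<Sum>j\<in>UNIV. (norm (column j X))\<^sup>2)"
proof -
  have "(norm X)\<^sup>2 = (\<Sum>i\<in>UNIV. \<Sum>j\<in>UNIV. (cmod (X $ i $ j))\<^sup>2)"
    by (simp add: norm_vec_def L2_set_def sum_nonneg)
  also have "\<dots> = (\<Sum>j\<in>UNIV. \<Sum>i\<in>UNIV. (cmod (X $ i $ j))\<^sup>2)"
    by (rule sum.swap)
  also have "\<dots> = (\<Sum>j\<in>UNIV. (norm (column j X))\<^sup>2)"
    by (simp add: norm_vec_def L2_set_def sum_nonneg column_def)
  finally show ?thesis .
qed

lemma column_matrix_mult: "column j (A ** X) = A *v column j X"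
  by (simp add: column_def matrix_matrix_mult_def matrix_vector_mult_def vec_eq_iff)

text \<open>The squared Frobenius norm is the sum of the squared column norms, and \<open>A\<close>
  acts on \<open>X\<close> column by column, so an operator bound carries over. A general
  \<open>K\<close> instead of \<open>spectral_norm A\<close> admits the frequency-dependent bounds
  for the resolvents.\<close>

lemma norm_matrix_mult_le:
  fixes A :: "complex ^ 'n ^ 'm" and X :: "complex ^ 'q ^ 'n"
  assumes "\<And>x. norm (A *v x) \<le> K * norm x" and "0 \<le> K"
  shows "norm (A ** X) \<le> K * norm X"
proof (rule power2_le_imp_le)
  have "(norm (A ** X))\<^sup>2 = (\<Sum>j\<in>UNIV. (norm (A *v column j X))\<^sup>2)"
    by (simp add: norm_squared_sum_columns column_matrix_mult)
  also have "\<dots> \<le> (\<Sum>j\<in>UNIV. (K * norm (column j X))\<^sup>2)"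
    by (intro sum_mono power_mono assms) simp
  also have "\<dots> = (K * norm X)\<^sup>2"
    by (simp add: power_mult_distrib norm_squared_sum_columns sum_distrib_left)
  finally show "(norm (A ** X))\<^sup>2 \<le> (K * norm X)\<^sup>2" .
qed (use assms in simp)

text \<open>\<open>spectral_norm F\<close> is a supremum over real vectors, whereas the resolvents
  produce complex ones. A real matrix acts separately on real and imaginary parts, whose squared
  norms add up, so the same constant serves over the complex numbers.\<close>

lemma norm_complex_matrix_mult_vec_le:
  fixes F :: "real ^ 'n ^ 'm"
  shows "norm (complex_matrix F *v x) \<le> spectral_norm F * norm x"
proof (rule power2_le_imp_le)
  define u where "u = (\<chi> i. Re (x $ i))"
  define v where "v = (\<chi> i. Im (x $ i))"
  have split: "(norm y)\<^sup>2 = (norm (\<chi> i. Re (y $ i)))\<^sup>2 + (norm (\<chi> i. Im (y $ i)))\<^sup>2"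
    for y :: "complex ^ 'k"
    by (simp add: norm_vec_def L2_set_def sum_nonneg cmod_power2 sum.distrib)
  have bound: "(norm (F *v w))\<^sup>2 \<le> (spectral_norm F)\<^sup>2 * (norm w)\<^sup>2" for w
    unfolding power_mult_distrib[symmetric] spectral_norm_def
    by (intro power_mono onorm) simp_all
  have "(norm (complex_matrix F *v x))\<^sup>2 = (norm (F *v u))\<^sup>2 + (norm (F *v v))\<^sup>2"
    by (subst split) (simp add: complex_matrix_def matrix_vector_mult_def u_def v_def)
  also have "\<dots> \<le> (spectral_norm F)\<^sup>2 * (norm u)\<^sup>2 + (spectral_norm F)\<^sup>2 * (norm v)\<^sup>2"
    by (intro add_mono bound)
  also have "\<dots> = (spectral_norm F * norm x)\<^sup>2"
    by (simp add: power_mult_distrib split[of x] u_def v_def distrib_left)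
  finally show "(norm (complex_matrix F *v x))\<^sup>2 \<le> (spectral_norm F * norm x)\<^sup>2" .
qed (simp add: spectral_norm_nonneg)

lemma norm_complex_matrix_mult_le:
  fixes F :: "real ^ 'n ^ 'm" and X :: "complex ^ 'q ^ 'n"
  shows "norm (complex_matrix F ** X) \<le> spectral_norm F * norm X"
  by (intro norm_matrix_mult_le norm_complex_matrix_mult_vec_le spectral_norm_nonneg)

section \<open>Resolvents on the imaginary axis and their perturbation\<close>

lemma pencil_mult_vec: "pencil A s *v x = s *s x - complex_matrix A *v x"
proof -
  have "mat s *v x = s *s x"
    by (simp add: matrix_vector_mult_def mat_def vec_eq_iff if_distrib if_distribR cong: if_cong)
  then show ?thesis
    by (simp add: pencil_def matrix_vector_mult_diff_rdistrib)
qed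

lemma pencil_add_mult_vec: "pencil (A + F) s *v x = pencil A s *v x - complex_matrix F *v x"
proof -
  have "complex_matrix (A + F) = complex_matrix A + complex_matrix F"
    by (simp add: complex_matrix_def vec_eq_iff)
  then show ?thesis
    by (simp add: pencil_mult_vec matrix_vector_mult_add_rdistrib)
qed

lemma
  assumes "invertible (pencil A s)"
  shows pencil_resolvent: "pencil A s *v (resolvent A s *v x) = x"
    and resolvent_pencil: "resolvent A s *v (pencil A s *v x) = x"
proof -
  \<comment> \<open>\<open>matrix_inv\<close> is a Hilbert choice; invertibility supplies the
    witness that makes it a two-sided inverse.\<close>
  have "pencil A s ** resolvent A s = mat 1 \<and> resolvent A s ** pencil A s = mat 1"
    using assms unfolding resolvent_def matrix_inv_def invertible_def by (rule someI_ex)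
  then show "pencil A s *v (resolvent A s *v x) = x"
    and "resolvent A s *v (pencil A s *v x) = x"
    by (simp_all add: matrix_vector_mul_assoc)
qed

lemma norm_vector_scalar_mult: "norm (s *s x) = cmod s * norm (x :: complex ^ 'n)"
  by (simp add: norm_vec_def L2_set_def norm_mult power_mult_distrib real_sqrt_mult
      flip: sum_distrib_left)

text \<open>Second resolvent identity \<open>R' = R + R F R'\<close>: the pencil of
  \<open>A + F\<close> is that of \<open>A\<close> minus \<open>F\<close>, so applying the pencil of
  \<open>A\<close> to \<open>R' x\<close> leaves \<open>x + F R' x\<close>.\<close>

lemma resolvent_perturbation:
  assumes "invertible (pencil A s)" and "invertible (pencil (A + F) s)"
  shows "resolvent (A + F) s *v x =
    resolvent A s *v (x + complex_matrix F *v (resolvent (A + F) s *v x))"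
proof -
  have "pencil A s *v (resolvent (A + F) s *v x) =
      x + complex_matrix F *v (resolvent (A + F) s *v x)"
    using pencil_resolvent[OF assms(2), of x] by (simp add: pencil_add_mult_vec algebra_simps)
  then show ?thesis
    using resolvent_pencil[OF assms(1)] by metis
qed

text \<open>The Neumann-type bound \<open>\<rho> / (1 - \<rho>)\<close> handles bounded frequencies; the decay in \<open>\<omega>\<close>
  comes from reading the resolvent equation as \<open>s y = x + (A + F) y\<close>.\<close>

lemma norm_perturbed_resolvent_le:
  fixes A F :: "real ^ 'n ^ 'n"
  assumes inv: "invertible (pencil A s)" "invertible (pencil (A + F) s)"
    and \<rho>: "spectral_norm (resolvent A s) \<le> \<rho>" "\<rho> < 1" and F: "spectral_norm F \<le> 1"
  shows "norm (resolvent (A + F) s *v x) \<le>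
    (1 + (spectral_norm A + 2) * (\<rho> / (1 - \<rho>))) / (1 + cmod s) * norm x"
proof -
  define y where "y = resolvent (A + F) s *v x"
  define a where "a = spectral_norm A"
  have \<rho>0: "0 \<le> \<rho>" and a0: "0 \<le> a"
    using \<rho> spectral_norm_nonneg[of "resolvent A s"] spectral_norm_nonneg[of A]
    by (auto simp: a_def)
  \<comment> \<open>Estimating \<open>F\<close> by 1 here keeps the final bound independent of
    \<open>F\<close>.\<close>
  have Fy: "norm (complex_matrix F *v y) \<le> norm y"
    using norm_complex_matrix_mult_vec_le[of F y] mult_right_mono[OF F norm_ge_zero[of y]]
    by simp
  have "norm y \<le> \<rho> * norm (x + complex_matrix F *v y)"
    using resolvent_perturbation[OF inv, of x]
      norm_matrix_vector_mult_le[of "resolvent A s" "x + complex_matrix F *v y"]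
      mult_right_mono[OF \<rho>(1) norm_ge_zero[of "x + complex_matrix F *v y"]]
    by (simp add: y_def)
  also have "\<dots> \<le> \<rho> * (norm x + norm y)"
    using Fy \<rho>0 norm_triangle_ineq[of x "complex_matrix F *v y"]
    by (intro mult_left_mono) linarith+
  finally have "norm y * (1 - \<rho>) \<le> \<rho> * norm x"
    by (simp add: algebra_simps)
  then have bounded: "norm y \<le> \<rho> / (1 - \<rho>) * norm x"
    using \<rho>(2) by (simp add: pos_le_divide_eq)
  have "s *s y = x + (complex_matrix A *v y + complex_matrix F *v y)"
    using pencil_resolvent[OF inv(2), of x]
    unfolding pencil_add_mult_vec unfolding pencil_mult_vec y_def[symmetric]
    by (simp add: algebra_simps)
  then have "cmod s * norm y = norm (x + (complex_matrix A *v y + complex_matrix F *v y))"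
    by (metis norm_vector_scalar_mult)
  also have "\<dots> \<le> norm x + (norm (complex_matrix A *v y) + norm (complex_matrix F *v y))"
    by (meson add_left_mono norm_triangle_ineq order_trans)
  also have "\<dots> \<le> norm x + (a * norm y + norm y)"
    using norm_complex_matrix_mult_vec_le[of A y] Fy by (simp add: a_def)
  \<comment> \<open>The 2 in \<open>a + 2\<close> collects one \<open>norm y\<close> from
    \<open>F\<close> and one from the summand 1 in \<open>1 + cmod s\<close>.\<close>
  finally have "(1 + cmod s) * norm y \<le> norm x + (a + 2) * norm y"
    by (simp add: algebra_simps)
  also have "\<dots> \<le> norm x + (a + 2) * (\<rho> / (1 - \<rho>) * norm x)"
    using bounded a0 by (intro add_left_mono mult_left_mono) auto
  finally have "(1 + cmod s) * norm y \<le> (1 + (a + 2) * (\<rho> / (1 - \<rho>))) * norm x"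
    by (simp add: algebra_simps)
  moreover have "0 < 1 + cmod s"
    by (simp add: add_pos_nonneg)
  ultimately show ?thesis
    by (simp add: pos_le_divide_eq mult.commute a_def y_def)
qed

text \<open>A supremum strictly below 1 gives a single \<open>\<rho>\<close> for all frequencies,
  which keeps \<open>1 - \<rho>\<close> bounded away from 0 in the Neumann-type estimate.\<close>

lemma spectral_norm_resolvent_le_hinf:
  assumes "hinf_norm 1 (\<lambda>s. resolvent A (s 1)) < 1"
  obtains \<rho> where "\<rho> < 1" "\<And>\<omega>. spectral_norm (resolvent A (\<i> * complex_of_real \<omega>)) \<le> \<rho>"
proof
  let ?h = "hinf_norm 1 (\<lambda>s. resolvent A (s 1))"
  have fin: "?h = ennreal (enn2real ?h)"
    using assms by (simp add: ennreal_enn2real_if)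
      (metis ennreal_one_less_top order.strict_trans less_irrefl)
  then show "enn2real ?h < 1"
    using assms by (metis enn2real_nonneg ennreal_1 ennreal_less_iff)
  fix \<omega> :: real
  \<comment> \<open>Points of the supremum's domain are extensional functions, hence the restriction
    to the index set.\<close>
  define w where "w = (\<lambda>j\<in>{1::nat..1}. \<omega>)"
  have "w \<in> {1..1} \<rightarrow>\<^sub>E UNIV"
    by (auto simp: w_def)
  then have "ennreal (spectral_norm (resolvent A (imaginary_axis w 1))) \<le> ?h"
    unfolding hinf_norm_def by (rule SUP_upper)
  then have "ennreal (spectral_norm (resolvent A (\<i> * complex_of_real \<omega>))) \<le> ennreal (enn2real ?h)"
    using fin by (simp add: imaginary_axis_def w_def)
  then show "spectral_norm (resolvent A (\<i> * complex_of_real \<omega>)) \<le> enn2real ?h"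
    by (simp add: ennreal_le_iff)
qed

text \<open>By the resolvent identity the difference is \<open>- R F R'\<close>; each of the two
  resolvents contributes a factor \<open>g\<close>.\<close>

lemma norm_resolvent_diff_le:
  fixes A F :: "real ^ 'n ^ 'n"
  assumes inv: "invertible (pencil A s)" "invertible (pencil (A + F) s)"
    and R: "\<And>x. norm (resolvent A s *v x) \<le> g * norm x"
    and R': "\<And>x. norm (resolvent (A + F) s *v x) \<le> g * norm x" and g: "0 \<le> g"
  shows "norm ((resolvent A s - resolvent (A + F) s) *v x) \<le> spectral_norm F * g * g * norm x"
proof -
  let ?y = "resolvent (A + F) s *v x"
  have "(resolvent A s - resolvent (A + F) s) *v x = - (resolvent A s *v (complex_matrix F *v ?y))"
    using resolvent_perturbation[OF inv, of x]
    by (simp add: matrix_vector_mult_diff_rdistrib matrix_vector_right_distrib algebra_simps)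
  then have "norm ((resolvent A s - resolvent (A + F) s) *v x) \<le> g * norm (complex_matrix F *v ?y)"
    using R by simp
  also have "\<dots> \<le> g * (spectral_norm F * (g * norm x))"
    using norm_complex_matrix_mult_vec_le[of F ?y] mult_left_mono[OF R' spectral_norm_nonneg[of F]] g
    by (intro mult_left_mono) (meson order_trans)+
  finally show ?thesis
    by (simp add: mult_ac)
qed

section \<open>Chains of resolvents and their differences\<close>

lemma matrix_mult_diff_ldistrib:
  fixes A :: "'a::comm_ring_1 ^ 'n ^ 'm"
  shows "A ** (X - Y) = A ** X - A ** Y"
  by (simp add: matrix_matrix_mult_def vec_eq_iff right_diff_distrib sum_subtractf)

lemma matrix_mult_diff_rdistrib:
  fixes A :: "'a::comm_ring_1 ^ 'n ^ 'm"
  shows "(A - B) ** X = A ** X - B ** X"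
  by (simp add: matrix_matrix_mult_def vec_eq_iff left_diff_distrib sum_subtractf)

text \<open>\<open>Suc k\<close> resolvents have \<open>k\<close> copies of \<open>N\<close> between
  them. This controls the unperturbed remainder of the chain in the telescoping estimate.\<close>

lemma norm_resolvent_chain_le:
  fixes A N :: "real ^ 'n ^ 'n" and b :: "real ^ 1 ^ 'n"
  assumes R: "\<And>j x. norm (resolvent A (s j) *v x) \<le> g j * norm x"
    and g: "\<And>j. 0 \<le> g j"
  shows "norm (resolvent_chain A N b (Suc k) s) \<le>
    norm (complex_matrix b) * spectral_norm N ^ k * (\<Prod>j=1..Suc k. g j)"
proof (induction k)
  case 0
  show ?case
    using norm_matrix_mult_le[OF R g, of 1 "complex_matrix b"] by (simp add: mult.commute)
next
  case (Suc k)
  let ?X = "resolvent_chain A N b (Suc k) s"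
  have "norm (resolvent_chain A N b (Suc (Suc k)) s) =
      norm (resolvent A (s (Suc (Suc k))) ** (complex_matrix N ** ?X))"
    by (simp add: matrix_mul_assoc)
  also have "\<dots> \<le> g (Suc (Suc k)) * norm (complex_matrix N ** ?X)"
    by (intro norm_matrix_mult_le R g)
  also have "\<dots> \<le> g (Suc (Suc k)) *
      (spectral_norm N * (norm (complex_matrix b) * spectral_norm N ^ k * (\<Prod>j=1..Suc k. g j)))"
    using norm_complex_matrix_mult_le[of N ?X] mult_left_mono[OF Suc.IH spectral_norm_nonneg] g
    by (intro mult_left_mono) (auto intro: order_trans)
  finally show ?case
    by (simp add: mult_ac)
qed

text \<open>Telescoping: each of the \<open>k + 1\<close> factors contributes one resolvent difference, and the
  surplus factor \<open>g j\<close> of that difference is absorbed into \<open>D\<close>.\<close>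

lemma norm_resolvent_chain_diff_le:
  fixes A N F :: "real ^ 'n ^ 'n" and b :: "real ^ 1 ^ 'n"
  assumes inv: "\<And>j. invertible (pencil A (s j))" "\<And>j. invertible (pencil (A + F) (s j))"
    and R: "\<And>j x. norm (resolvent A (s j) *v x) \<le> g j * norm x"
    and R': "\<And>j x. norm (resolvent (A + F) (s j) *v x) \<le> g j * norm x"
    and g: "\<And>j. 0 \<le> g j" "\<And>j. g j \<le> D"
  shows "norm (resolvent_chain A N b (Suc k) s - resolvent_chain (A + F) N b (Suc k) s) \<le>
    spectral_norm F * D * real (Suc k) *
      (norm (complex_matrix b) * spectral_norm N ^ k * (\<Prod>j=1..Suc k. g j))"
proof -
  have diff: "norm ((resolvent A (s j) - resolvent (A + F) (s j)) ** Y) \<le>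
      spectral_norm F * D * g j * norm Y" for j and Y :: "complex ^ 1 ^ 'n"
  proof (rule norm_matrix_mult_le)
    fix x
    have "norm ((resolvent A (s j) - resolvent (A + F) (s j)) *v x) \<le>
        spectral_norm F * g j * g j * norm x"
      by (intro norm_resolvent_diff_le inv R R' g)
    also have "\<dots> \<le> spectral_norm F * D * g j * norm x"
      by (intro mult_right_mono mult_left_mono g spectral_norm_nonneg) simp
    finally show "norm ((resolvent A (s j) - resolvent (A + F) (s j)) *v x) \<le>
        spectral_norm F * D * g j * norm x" .
  next
    show "0 \<le> spectral_norm F * D * g j"
      using g[of j] by (intro mult_nonneg_nonneg spectral_norm_nonneg) auto
  qed
  show ?thesis
  proof (induction k)
    case 0
    show ?case
      using diff[of 1 "complex_matrix b"] by (simp add: mult_ac matrix_mult_diff_rdistrib)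
  next
    case (Suc k)
    let ?X = "resolvent_chain A N b (Suc k) s" and ?Y = "resolvent_chain (A + F) N b (Suc k) s"
    let ?B = "norm (complex_matrix b) * spectral_norm N ^ k * (\<Prod>j=1..Suc k. g j)"
    let ?R = "resolvent A (s (Suc (Suc k)))" and ?R' = "resolvent (A + F) (s (Suc (Suc k)))"
    let ?g = "g (Suc (Suc k))" and ?f = "spectral_norm F * D"
    have f: "0 \<le> ?f"
      using g[of 1] by (intro mult_nonneg_nonneg spectral_norm_nonneg) auto
    \<comment> \<open>\<open>R N X - R' N Y\<close> is split so that the first summand isolates the
      newest resolvent difference and the second leaves \<open>X - Y\<close> to the induction
      hypothesis. They contribute 1 and \<open>Suc k\<close> to the factor counting the
      resolvents.\<close>
    have "resolvent_chain A N b (Suc (Suc k)) s - resolvent_chain (A + F) N b (Suc (Suc k)) s =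
        (?R - ?R') ** (complex_matrix N ** ?X) + ?R' ** (complex_matrix N ** (?X - ?Y))"
      by (simp add: matrix_mul_assoc matrix_mult_diff_ldistrib matrix_mult_diff_rdistrib)
    also have "norm \<dots> \<le> ?f * ?g * norm (complex_matrix N ** ?X) +
        ?g * norm (complex_matrix N ** (?X - ?Y))"
      by (intro norm_triangle_mono diff norm_matrix_mult_le[OF R' g(1)])
    also have "\<dots> \<le> ?f * ?g * (spectral_norm N * ?B) +
        ?g * (spectral_norm N * (?f * real (Suc k) * ?B))"
    proof (intro add_mono mult_left_mono)
      show "norm (complex_matrix N ** ?X) \<le> spectral_norm N * ?B"
        using norm_complex_matrix_mult_le[of N ?X]
          mult_left_mono[OF norm_resolvent_chain_le[where s = s, OF R g(1)] spectral_norm_nonneg]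
        by (rule order_trans)
      show "norm (complex_matrix N ** (?X - ?Y)) \<le> spectral_norm N * (?f * real (Suc k) * ?B)"
        using norm_complex_matrix_mult_le[of N "?X - ?Y"]
          mult_left_mono[OF Suc.IH spectral_norm_nonneg]
        by (rule order_trans)
    qed (use f g in auto)
    finally show ?case
      by (simp add: algebra_simps)
  qed
qed

section \<open>From pointwise decay to the H2 norm\<close>

lemma nn_integral_inverse_1_plus_square:
  obtains J where "0 \<le> J" "(\<integral>\<^sup>+x. ennreal (inverse (1 + x\<^sup>2)) \<partial>lborel) = ennreal J"
proof
  have "integrable lborel (\<lambda>x::real. inverse (1 + x\<^sup>2))"
    using integrable_inverse_1_plus_square by (simp add: set_integrable_def)
  then show "(\<integral>\<^sup>+x. ennreal (inverse (1 + x\<^sup>2)) \<partial>lborel) =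
      ennreal (\<integral>x. inverse (1 + x\<^sup>2) \<partial>lborel)"
    by (rule nn_integral_eq_integral) simp
qed simp

text \<open>The squared decay factor is at most \<open>1 / (1 + x^2)\<close> in each coordinate.
  This majorant is a product of one-variable functions, so its integral over the product measure
  factors into the power \<open>J ^ k\<close>.\<close>

lemma h2_norm_squared_le:
  fixes H :: "(nat \<Rightarrow> complex) \<Rightarrow> complex ^ 'q ^ 'p"
  assumes bound: "\<And>\<omega>. norm (H (imaginary_axis \<omega>)) \<le> E * (\<Prod>j=1..k. 1 / (1 + \<bar>\<omega> j\<bar>))"
    and J: "0 \<le> J" "(\<integral>\<^sup>+x. ennreal (inverse (1 + x\<^sup>2)) \<partial>lborel) = ennreal J"
  shows "h2_norm_squared k H \<le> ennreal ((1 / (2 * pi)) ^ k * E\<^sup>2 * J ^ k)"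
proof -
  interpret product_sigma_finite "\<lambda>_::nat. lborel :: real measure" ..
  have "(frobenius_norm (H (imaginary_axis \<omega>)))\<^sup>2 \<le> E\<^sup>2 * (\<Prod>j=1..k. inverse (1 + (\<omega> j)\<^sup>2))" for \<omega>
  proof -
    have "(frobenius_norm (H (imaginary_axis \<omega>)))\<^sup>2 \<le> (E * (\<Prod>j=1..k. 1 / (1 + \<bar>\<omega> j\<bar>)))\<^sup>2"
      unfolding frobenius_norm_eq_norm by (intro power_mono bound) simp
    also have "\<dots> = E\<^sup>2 * (\<Prod>j=1..k. (1 / (1 + \<bar>\<omega> j\<bar>))\<^sup>2)"
      by (simp add: power_mult_distrib prod_power_distrib)
    also have "\<dots> \<le> E\<^sup>2 * (\<Prod>j=1..k. inverse (1 + (\<omega> j)\<^sup>2))"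
    proof (intro mult_left_mono prod_mono conjI)
      fix j
      have "1 + (\<omega> j)\<^sup>2 \<le> (1 + \<bar>\<omega> j\<bar>)\<^sup>2"
        by (simp add: power2_sum)
      moreover have "0 < 1 + (\<omega> j)\<^sup>2"
        by (simp add: add_pos_nonneg)
      ultimately show "(1 / (1 + \<bar>\<omega> j\<bar>))\<^sup>2 \<le> inverse (1 + (\<omega> j)\<^sup>2)"
        by (simp add: power_divide divide_simps)
    qed simp_all
    finally show ?thesis .
  qed
  then have "ennreal ((frobenius_norm (H (imaginary_axis \<omega>)))\<^sup>2) \<le>
      ennreal (E\<^sup>2) * (\<Prod>j=1..k. ennreal (inverse (1 + (\<omega> j)\<^sup>2)))" for \<omega>
    by (subst prod_ennreal, simp, subst ennreal_mult[symmetric])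
      (auto intro!: ennreal_leI prod_nonneg)
  then have "(\<integral>\<^sup>+ \<omega>. ennreal ((frobenius_norm (H (imaginary_axis \<omega>)))\<^sup>2)
        \<partial>(\<Pi>\<^sub>M j\<in>{1..k}. lborel)) \<le>
      (\<integral>\<^sup>+ \<omega>. ennreal (E\<^sup>2) * (\<Prod>j=1..k. ennreal (inverse (1 + (\<omega> j)\<^sup>2)))
        \<partial>(\<Pi>\<^sub>M j\<in>{1..k}. lborel))"
    by (intro nn_integral_mono)
  also have "\<dots> = ennreal (E\<^sup>2) * (\<integral>\<^sup>+ \<omega>. (\<Prod>j=1..k. ennreal (inverse (1 + (\<omega> j)\<^sup>2)))
        \<partial>(\<Pi>\<^sub>M j\<in>{1..k}. lborel))"
    by (intro nn_integral_cmult) measurable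
  also have "\<dots> = ennreal (E\<^sup>2) * ennreal J ^ k"
    by (subst product_nn_integral_prod) (simp_all add: J)
  finally have "h2_norm_squared k H \<le>
      ennreal ((1 / (2 * pi)) ^ k) * (ennreal (E\<^sup>2) * ennreal J ^ k)"
    unfolding h2_norm_squared_def by (intro mult_left_mono) simp_all
  also have "\<dots> = ennreal ((1 / (2 * pi)) ^ k * E\<^sup>2 * J ^ k)"
    using J(1) by (simp add: ennreal_power ennreal_mult mult.assoc)
  finally show ?thesis .
qed

text \<open>The constant is fixed before \<open>F\<close>: it is built from \<open>\<rho>\<close>,
  \<open>J\<close>, \<open>D\<close> and \<open>E\<close>, which depend only on \<open>A\<close>,
  \<open>N\<close>, \<open>b\<close>, \<open>c\<close> and \<open>k\<close>.\<close>

lemma h2_norm_squared_transfer_error_le: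
  fixes A N :: "real ^ 'n ^ 'n" and b :: "real ^ 1 ^ 'n" and c :: "real ^ 'n ^ 1"
  assumes inv: "invertible_on_imaginary_axis A"
    and hinf: "hinf_norm 1 (\<lambda>s. resolvent A (s 1)) < 1" and k: "k \<ge> 1"
  obtains C where "0 \<le> C"
    "\<And>F. admissible_perturbation A N b c k F \<Longrightarrow>
      h2_norm_squared k (transfer_error A N b c k F) \<le> ennreal (C * (spectral_norm F)\<^sup>2)"
proof -
  obtain \<rho> where \<rho>: "\<rho> < 1" "\<And>\<omega>. spectral_norm (resolvent A (\<i> * complex_of_real \<omega>)) \<le> \<rho>"
    using spectral_norm_resolvent_le_hinf[OF hinf] by blast
  obtain J where J: "0 \<le> J" "(\<integral>\<^sup>+x. ennreal (inverse (1 + x\<^sup>2)) \<partial>lborel) = ennreal J"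
    using nn_integral_inverse_1_plus_square .
  define D where "D = 1 + (spectral_norm A + 2) * (\<rho> / (1 - \<rho>))"
  have D: "0 \<le> D"
    using \<rho> spectral_norm_nonneg[of "resolvent A (\<i> * complex_of_real 0)"]
      spectral_norm_nonneg[of A] order_trans[OF spectral_norm_nonneg \<rho>(2)[of 0]]
    by (auto simp: D_def intro!: add_nonneg_nonneg mult_nonneg_nonneg divide_nonneg_nonneg)
  \<comment> \<open>The first \<open>D\<close> absorbs the surplus resolvent bound and
    \<open>k\<close> counts the telescoping terms; \<open>D ^ k\<close> comes from the numerators of
    the \<open>k\<close> factors \<open>D / (1 + |omega j|)\<close>.\<close>
  define E where "E = spectral_norm c * D * real k *
    (norm (complex_matrix b) * spectral_norm N ^ (k - 1) * D ^ k)"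
  have decay: "norm (resolvent (A + F) (\<i> * complex_of_real \<omega>) *v x) \<le> D / (1 + \<bar>\<omega>\<bar>) * norm x"
    if "spectral_norm F < 1" "invertible_on_imaginary_axis (A + F)" for F \<omega> x
    using norm_perturbed_resolvent_le[of A "\<i> * complex_of_real \<omega>" F \<rho> x] inv that \<rho>
    by (simp add: invertible_on_imaginary_axis_def D_def norm_mult)
  \<comment> \<open>The unperturbed resolvent is the case \<open>F = 0\<close>.\<close>
  have decay0: "norm (resolvent A (\<i> * complex_of_real \<omega>) *v x) \<le> D / (1 + \<bar>\<omega>\<bar>) * norm x" for \<omega> x
    using decay[of 0] inv by (simp add: spectral_norm_def onorm_zero)
  show thesis
  proof
    show "0 \<le> (1 / (2 * pi)) ^ k * E\<^sup>2 * J ^ k"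
      using J(1) by simp
    fix F assume F: "admissible_perturbation A N b c k F"
    show "h2_norm_squared k (transfer_error A N b c k F) \<le>
        ennreal ((1 / (2 * pi)) ^ k * E\<^sup>2 * J ^ k * (spectral_norm F)\<^sup>2)"
    proof -
      have "norm (transfer_error A N b c k F (imaginary_axis \<omega>)) \<le>
          E * spectral_norm F * (\<Prod>j=1..k. 1 / (1 + \<bar>\<omega> j\<bar>))" for \<omega>
      proof -
        let ?s = "imaginary_axis \<omega>"
        \<comment> \<open>The chain estimates are stated for \<open>Suc\<close> because the chain of
          length 0 is a dummy; \<open>k >= 1\<close> gives \<open>Suc (k - 1) = k\<close>.\<close>
        let ?d = "resolvent_chain A N b (Suc (k - 1)) ?s - resolvent_chain (A + F) N b (Suc (k - 1)) ?s"
        have "norm (transfer_error A N b c k F ?s) = norm (complex_matrix c ** ?d)"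
          using k by (simp add: transfer_error_def transfer_function_def matrix_mult_diff_ldistrib)
        also have "\<dots> \<le> spectral_norm c * norm ?d"
          by (rule norm_complex_matrix_mult_le)
        also have "\<dots> \<le> spectral_norm c * (spectral_norm F * D * real (Suc (k - 1)) *
            (norm (complex_matrix b) * spectral_norm N ^ (k - 1) *
              (\<Prod>j=1..Suc (k - 1). D / (1 + \<bar>\<omega> j\<bar>))))"
        proof (intro mult_left_mono norm_resolvent_chain_diff_le spectral_norm_nonneg order_refl)
          fix j
          show "invertible (pencil A (?s j))" "invertible (pencil (A + F) (?s j))"
            using inv F
            by (simp_all add: imaginary_axis_def invertible_on_imaginary_axis_def
                admissible_perturbation_def)
          show "0 \<le> D / (1 + \<bar>\<omega> j\<bar>)" "D / (1 + \<bar>\<omega> j\<bar>) \<le> D"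
            using D by (simp_all add: divide_le_eq mult_le_cancel_left1)
          show "norm (resolvent A (?s j) *v x) \<le> D / (1 + \<bar>\<omega> j\<bar>) * norm x"
            "norm (resolvent (A + F) (?s j) *v x) \<le> D / (1 + \<bar>\<omega> j\<bar>) * norm x" for x
            using F decay decay0 by (simp_all add: imaginary_axis_def admissible_perturbation_def)
        qed
        also have "\<dots> = E * spectral_norm F * (\<Prod>j=1..k. 1 / (1 + \<bar>\<omega> j\<bar>))"
          using k by (simp add: E_def prod_dividef mult_ac)
        finally show ?thesis .
      qed
      \<comment> \<open>Taking \<open>E * spectral_norm F\<close> as the amplitude makes its square
        yield the factor \<open>(spectral_norm F)^2\<close>.\<close>
      then show ?thesis
        using h2_norm_squared_le[OF _ J, of "transfer_error A N b c k F" "E * spectral_norm F" k]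
        by (simp add: power_mult_distrib mult_ac)
    qed
  qed
qed

theorem theorem8:
  fixes A N :: "real ^ 'n ^ 'n" and b :: "real ^ 1 ^ 'n" and c :: "real ^ 'n ^ 1" and M :: nat
  assumes "M \<ge> 1"
    and "invertible_on_imaginary_axis A"
    and "hinf_norm 1 (\<lambda>s. resolvent A (s 1)) < 1"
  shows "(\<exists>C\<ge>0. \<forall>F. admissible_perturbation A N b c M F \<longrightarrow>
            (h2_norm M (transfer_error A N b c M F))\<^sup>2 \<le> ennreal (C * (spectral_norm F)\<^sup>2))
         \<and> second_backward_stability_condition A N b c M"
proof
  show "\<exists>C\<ge>0. \<forall>F. admissible_perturbation A N b c M F \<longrightarrow>
      (h2_norm M (transfer_error A N b c M F))\<^sup>2 \<le> ennreal (C * (spectral_norm F)\<^sup>2)"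
    using h2_norm_squared_transfer_error_le[OF assms(2,3,1), of N b c]
    unfolding h2_norm_power2 by metis
  show "second_backward_stability_condition A N b c M"
    unfolding second_backward_stability_condition_def
  proof
    fix k assume "k \<in> {1..M}"
    then obtain C where C: "0 \<le> C"
      "\<And>F. admissible_perturbation A N b c k F \<Longrightarrow>
        h2_norm_squared k (transfer_error A N b c k F) \<le> ennreal (C * (spectral_norm F)\<^sup>2)"
      using h2_norm_squared_transfer_error_le[OF assms(2,3), of k N b c] by auto
    have "h2_norm k (transfer_error A N b c k F) \<le> ennreal (sqrt C * spectral_norm F)"
      if F: "admissible_perturbation A N b c k F" for F
    proof -
      have "enn2real (h2_norm_squared k (transfer_error A N b c k F)) \<le> C * (spectral_norm F)\<^sup>2"
        using C F by (intro enn2real_leI) auto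
      then have "sqrt (enn2real (h2_norm_squared k (transfer_error A N b c k F))) \<le>
          sqrt C * spectral_norm F"
        by (metis real_sqrt_le_iff real_sqrt_mult real_sqrt_unique spectral_norm_nonneg)
      \<comment> \<open>This excludes the infinite branch of \<open>h2_norm\<close>;
        \<open>enn2real\<close> would send an infinite value to 0.\<close>
      moreover have "h2_norm_squared k (transfer_error A N b c k F) \<noteq> \<infinity>"
        using C(2)[OF F] by (auto simp: top_unique)
      ultimately show ?thesis
        by (simp add: h2_norm_def ennreal_leI)
    qed
    then show "\<exists>C\<ge>0. \<forall>F. admissible_perturbation A N b c k F \<longrightarrow>
        h2_norm k (transfer_error A N b c k F) \<le> ennreal (C * spectral_norm F)"
      using C(1) by (intro exI[of _ "sqrt C"]) simp
  qed
qed

end
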